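(* Let $c>0$ and $\alpha>3$, and let $(x_k)$ be a sequence in $\mathcal H$ generated from arbitrary $x_0,x_1\in\mathcal H$ by the algorithm (IPATRE): for $k\ge1$, $$y_k=x_k+\left(1-\frac{\alpha}{k}\right)(x_k-x_{k-1}),\qquad x_{k+1}=\operatorname{prox}_f\left(y_k-\frac{c}{k^2}x_k\right).$$ Let $x^*$ be the minimum norm element of $\operatorname{argmin} f$. Then $\liminf_{k\to+\infty}\|x_k-x^*\|=0$. Further, $(x_k)$ converges strongly to $x^*$ whenever $x_k$ is in the interior of the ball $B(0,\|x^*\|)$ for all $k$ large enough, or $x_k$ is in the complement of the ball $B(0,\|x^*\|)$ for all $k$ large enough.
   Context: $\mathcal H$ is a real Hilbert space with norm $\|\cdot\|$. The function $f:\mathcal H\to\mathbb R$ is convex and differentiable, $\nabla f$ is Lipschitz continuous on bounded sets, and $\operatorname{argmin} f\ne\emptyset$. $\operatorname{prox}_f(x)=\operatorname{argmin}_{z\in\mathcal H}\{f(z)+\frac12\|z-x\|^2\}$. $B(0,\rho)=\{x\in\mathcal H:\|x\|<\rho\}$ is the open ball, so its complement is $\{x:\|x\|\ge\rho\}$. *)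

theory Defs
  imports "HOL-Analysis.Analysis"
begin

definition argmin_set :: "('a \<Rightarrow> real) \<Rightarrow> 'a set" where
  "argmin_set f = {x. is_arg_min f (\<lambda>_. True) x}"

text \<open>
  The library function \<^const>\<open>arg_min\<close> is a choice operator; it denotes the proximal point proper
  because, for a continuous convex \<open>f\<close> on a Hilbert space, the objective below is strongly convex and
  has exactly one minimiser.
\<close>

definition prox :: "('a::real_inner \<Rightarrow> real) \<Rightarrow> 'a \<Rightarrow> 'a" where
  "prox f x = arg_min (\<lambda>z. f z + 1 / 2 * (norm (z - x))\<^sup>2) (\<lambda>_. True)"

end

theory Submission
  imports Defs
begin

text \<open>
  In the time scale \<open>\<sigma> = ln t\<close> the differential equation behind the algorithm,
  \<open>x'' + (\<alpha>/t) x' + \<nabla>f(x) + (c/t\<^sup>2) x = 0\<close>, becomes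
  \<open>x'' + (\<alpha>-1) x' + exp(2\<sigma>) \<nabla>f(x) + c x = 0\<close>: the damping and the Tikhonov term have constant
  coefficients, and only the potential \<open>f\<close> is amplified (primes now denote derivatives in \<open>\<sigma>\<close>). For \<open>2 < b < \<alpha>-1\<close> and a minimiser \<open>p\<close> of
  \<open>f\<close>, the energy
  \<open>E = |b(x-p) + x'|\<^sup>2/2 + b(\<alpha>-1-b)|x-p|\<^sup>2/2 + exp(2\<sigma>) (f(x)-f(p)) + c(|x|\<^sup>2-s)/2\<close>
  therefore satisfies \<open>E' \<le> -\<delta> E + cb(|p|\<^sup>2-s)/2\<close> as long as \<open>|x|\<^sup>2 \<ge> s\<close>, for some \<open>\<delta> > 0\<close>.
  The level \<open>s\<close> is free, and two choices of it do all the work: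
  \<^item> with \<open>s = 0\<close> the constraint is void and \<open>E\<close> stays bounded, so \<open>f(x) \<rightarrow> f(p)\<close>;
  \<^item> with \<open>s = |p|\<^sup>2\<close> the constant term disappears and \<open>E \<rightarrow> 0\<close>, so \<open>x \<rightarrow> p\<close> whenever the trajectory
    finally stays outside the ball of radius \<open>|p|\<close>.

  The discrete counterpart, with time steps \<open>1/k\<close> for \<open>\<sigma>\<close>, is \<open>energy_decay\<close>. It sees the proximal
  step only through the inequality expressing that \<open>w - prox f w\<close> is a subgradient of \<open>f\<close> at
  \<open>prox f w\<close>.

  Iterates inside the ball are treated by a different argument. A minimising sequence cannot have norms
  much below the norm of the minimum norm minimiser \<open>p\<close> (\<open>min_norm_minimiser\<close>). Applied to the
  midpoints with \<open>p\<close>, whose values are almost minimal by convexity, this forces a minimising sequence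
  inside the ball of radius \<open>|p|\<close> to converge to \<open>p\<close> in norm, by the parallelogram law. So if infinitely
  many iterates lie inside the ball, they form a subsequence converging to \<open>p\<close>; otherwise all but finitely
  many lie outside, and the energy argument applies. In both cases the lower limit vanishes.
\<close>

section \<open>Minimisers of strongly convex functions\<close>

text \<open>
  A constant family \<open>S\<close> gives the existence of a minimiser, as needed for the proximal point;
  a family of shrinking sublevel sets of \<open>f\<close> gives the minimum norm minimiser of \<open>f\<close>. The second
  conclusion says more than minimality of \<open>p\<close> on the intersection: the infimum over \<open>S n\<close> tends to
  \<open>\<phi> p\<close>. In a Hilbert space weak compactness would yield this; here strong convexity makes
  almost minimising points of the \<open>S n\<close> a Cauchy sequence, because their midpoints stay in the sets
  and cannot do much better than the limiting infimum \<open>m\<close>.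
\<close>

lemma nested_strongly_convex_minimum:
  fixes \<phi> :: "'a::{real_normed_vector, complete_space} \<Rightarrow> real" and S :: "nat \<Rightarrow> 'a set"
  assumes strong: "\<And>u v. \<phi> (midpoint u v) \<le> (\<phi> u + \<phi> v) / 2 - \<kappa> * (norm (u - v))\<^sup>2"
    and "\<kappa> > 0"
    and cont: "continuous_on UNIV \<phi>"
    and below: "\<And>u. B \<le> \<phi> u"
    and closed: "\<And>n. closed (S n)"
    and dec: "decseq S"
    and mid: "\<And>n u v. u \<in> S n \<Longrightarrow> v \<in> S n \<Longrightarrow> midpoint u v \<in> S n"
    and z0: "\<And>n. z0 \<in> S n"
  obtains p where "\<And>n. p \<in> S n" and "\<And>\<epsilon>. \<epsilon> > 0 \<Longrightarrow> \<exists>n. \<forall>w\<in>S n. \<phi> p - \<epsilon> < \<phi> w"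
proof -
  \<comment> \<open>The infimum of \<open>A\<close> is the supremum over \<open>n\<close> of the infima of \<open>\<phi>\<close> over \<open>S n\<close>.\<close>
  define A where "A = {r. \<forall>n. \<exists>w\<in>S n. \<phi> w \<le> r}"
  define m where "m = Inf A"
  have "\<phi> z0 \<in> A"
    using z0 by (auto simp: A_def)
  have bdd: "bdd_below A"
  proof (rule bdd_belowI)
    fix r
    assume "r \<in> A"
    then obtain w where "\<phi> w \<le> r"
      unfolding A_def by blast
    with below[of w] show "B \<le> r"
      by linarith
  qed
  have upper: "\<exists>w\<in>S n. \<phi> w \<le> m + \<epsilon>" if "\<epsilon> > 0" for \<epsilon> n
  proof -
    have "A \<noteq> {}" and "Inf A < m + \<epsilon>"
      using \<open>\<phi> z0 \<in> A\<close> that by (auto simp: m_def)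
    then obtain r where "r \<in> A" "r < m + \<epsilon>"
      using cInf_lessD by blast
    moreover from \<open>r \<in> A\<close> obtain w where "w \<in> S n" "\<phi> w \<le> r"
      unfolding A_def by blast
    ultimately show ?thesis
      by (intro bexI[of _ w]) auto
  qed
  have lower: "\<exists>n. \<forall>w\<in>S n. m - \<epsilon> < \<phi> w" if "\<epsilon> > 0" for \<epsilon>
  proof -
    have "m - \<epsilon> \<notin> A"
      using cInf_lower[OF _ bdd, of "m - \<epsilon>"] that unfolding m_def by auto
    then show ?thesis
      unfolding A_def by (auto simp: not_le)
  qed
  have "\<exists>w. \<forall>n. w n \<in> S n \<and> \<phi> (w n) \<le> m + inverse (real (Suc n))"
    using upper by (intro choice) (metis inverse_positive_iff_positive of_nat_0_less_iff zero_less_Suc)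
  then obtain w where wS: "\<And>n. w n \<in> S n"
    and w_le: "\<And>n. \<phi> (w n) \<le> m + inverse (real (Suc n))"
    by blast
  have "Cauchy w"
  proof (rule CauchyI)
    fix e :: real
    assume "e > 0"
    define \<epsilon> where "\<epsilon> = \<kappa> * e\<^sup>2 / 4"
    have "\<epsilon> > 0"
      using \<open>e > 0\<close> \<open>\<kappa> > 0\<close> by (simp add: \<epsilon>_def)
    obtain n where n: "\<And>w. w \<in> S n \<Longrightarrow> m - \<epsilon> < \<phi> w"
      using lower[OF \<open>\<epsilon> > 0\<close>] by blast
    obtain N where N: "inverse (real (Suc N)) < \<epsilon>"
      using reals_Archimedean[OF \<open>\<epsilon> > 0\<close>] by blast
    have small: "w i \<in> S n \<and> \<phi> (w i) \<le> m + \<epsilon>" if "i \<ge> max n N" for i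
    proof
      show "w i \<in> S n"
        using wS[of i] decseqD[OF dec, of n i] that by auto
      have "inverse (real (Suc i)) \<le> inverse (real (Suc N))"
        using that by (intro le_imp_inverse_le) auto
      then show "\<phi> (w i) \<le> m + \<epsilon>"
        using w_le[of i] N by linarith
    qed
    show "\<exists>M. \<forall>i\<ge>M. \<forall>j\<ge>M. norm (w i - w j) < e"
    proof (intro exI allI impI)
      fix i j
      assume ij: "i \<ge> max n N" "j \<ge> max n N"
      have "m - \<epsilon> < (\<phi> (w i) + \<phi> (w j)) / 2 - \<kappa> * (norm (w i - w j))\<^sup>2"
        using n[OF mid[of "w i" n "w j"]] small[OF ij(1)] small[OF ij(2)] strong[of "w i" "w j"]
        by auto
      then have "\<kappa> * (norm (w i - w j))\<^sup>2 < 2 * \<epsilon>"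
        using small[OF ij(1), THEN conjunct2] small[OF ij(2), THEN conjunct2] by argo
      also have "\<dots> < \<kappa> * e\<^sup>2"
        using \<open>\<epsilon> > 0\<close> by (simp add: \<epsilon>_def)
      finally have "(norm (w i - w j))\<^sup>2 < e\<^sup>2"
        using \<open>\<kappa> > 0\<close> by simp
      then show "norm (w i - w j) < e"
        using \<open>e > 0\<close> by (auto intro: power_less_imp_less_base)
    qed
  qed
  then obtain p where lim: "w \<longlonglongrightarrow> p"
    using Cauchy_convergent_iff convergent_def by blast
  have pS: "p \<in> S n" for n
  proof (rule Lim_in_closed_set[OF closed _ _ lim])
    show "\<forall>\<^sub>F i in sequentially. w i \<in> S n"
      using eventually_ge_at_top[of n] by eventually_elim (use wS decseqD[OF dec] in blast)
  qed simp
  have "(\<lambda>n. \<phi> (w n)) \<longlonglongrightarrow> \<phi> p"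
    using continuous_on_tendsto_compose[OF cont lim] by simp
  moreover have "(\<lambda>n. m + inverse (real (Suc n))) \<longlonglongrightarrow> m + 0"
    by (intro tendsto_intros LIMSEQ_inverse_real_of_nat)
  ultimately have "\<phi> p \<le> m"
    using w_le by (intro LIMSEQ_le[of "\<lambda>n. \<phi> (w n)" _ "\<lambda>n. m + inverse (real (Suc n))"]) auto
  with lower have "\<exists>n. \<forall>w\<in>S n. \<phi> p - \<epsilon> < \<phi> w" if "\<epsilon> > 0" for \<epsilon>
    using that by (meson diff_right_mono le_less_trans)
  with pS show ?thesis
    by (rule that)
qed

lemma convex_on_midpoint:
  fixes f :: "'a::real_vector \<Rightarrow> real"
  assumes "convex_on UNIV f"
  shows "f (midpoint u v) \<le> (f u + f v) / 2"
proof -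
  have "midpoint u v = (1 - 1/2) *\<^sub>R u + (1/2) *\<^sub>R v"
    by (simp add: midpoint_def scaleR_right_distrib)
  then show ?thesis
    using convex_onD[OF assms, of "1/2" u v] by (simp add: field_simps)
qed

lemma norm_midpoint_sq:
  fixes u v w :: "'a::real_inner"
  shows "(norm (midpoint u v - w))\<^sup>2 = ((norm (u - w))\<^sup>2 + (norm (v - w))\<^sup>2) / 2 - (norm (u - v))\<^sup>2 / 4"
  unfolding midpoint_def power2_norm_eq_inner
  by (simp add: inner_simps inner_commute field_simps)

section \<open>The proximal step\<close>

lemma prox_is_arg_min:
  fixes f :: "'a::{real_inner, complete_space} \<Rightarrow> real"
  assumes "convex_on UNIV f" and "continuous_on UNIV f" and "\<And>u. B \<le> f u"
  shows "f (prox f w) + 1 / 2 * (norm (prox f w - w))\<^sup>2 \<le> f z + 1 / 2 * (norm (z - w))\<^sup>2"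
proof -
  define \<phi> where "\<phi> z = f z + 1 / 2 * (norm (z - w))\<^sup>2" for z
  obtain p where p: "\<And>\<epsilon>. \<epsilon> > 0 \<Longrightarrow> \<forall>u. \<phi> p - \<epsilon> < \<phi> u"
  proof (rule nested_strongly_convex_minimum[of \<phi> "1/8" B "\<lambda>_. UNIV" w])
    show "\<phi> (midpoint u v) \<le> (\<phi> u + \<phi> v) / 2 - 1 / 8 * (norm (u - v))\<^sup>2" for u v
      using convex_on_midpoint[OF assms(1), of u v]
      by (simp add: \<phi>_def norm_midpoint_sq field_simps)
    show "continuous_on UNIV \<phi>"
      unfolding \<phi>_def by (intro continuous_intros assms)
    show "B \<le> \<phi> u" for u
      using assms(3)[of u] by (simp add: \<phi>_def add_increasing2)
  qed (auto simp: decseq_def)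
  have "is_arg_min \<phi> (\<lambda>_. True) p"
    unfolding is_arg_min_def
  proof (intro conjI notI)
    assume "\<exists>u. True \<and> \<phi> u < \<phi> p"
    then obtain u where "\<phi> u < \<phi> p"
      by blast
    then have "\<phi> p - (\<phi> p - \<phi> u) < \<phi> u"
      by (intro p[rule_format]) simp
    then show False
      by simp
  qed simp
  then have "is_arg_min \<phi> (\<lambda>_. True) (arg_min \<phi> (\<lambda>_. True))"
    unfolding arg_min_def by (rule someI)
  then show ?thesis
    unfolding is_arg_min_def prox_def \<phi>_def by (auto simp: not_less)
qed

text \<open>
  Comparing the proximal point with points of the segment to \<open>z\<close> and letting the segment shrink gives
  Fermat's rule in the form of a subgradient inequality.
\<close>

lemma prox_subgradient:
  fixes f :: "'a::{real_inner, complete_space} \<Rightarrow> real"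
  assumes "convex_on UNIV f" and "continuous_on UNIV f" and "\<And>u. B \<le> f u"
  shows "f (prox f w) + (w - prox f w) \<bullet> (z - prox f w) \<le> f z"
proof -
  define p where "p = prox f w"
  define e where "e = z - p"
  have ineq: "0 \<le> f z - f p - (w - p) \<bullet> e + t * ((norm e)\<^sup>2 / 2)" if t: "0 < t" "t < 1" for t
  proof -
    have "f p + 1 / 2 * (norm (p - w))\<^sup>2
        \<le> f ((1 - t) *\<^sub>R p + t *\<^sub>R z) + 1 / 2 * (norm ((1 - t) *\<^sub>R p + t *\<^sub>R z - w))\<^sup>2"
      unfolding p_def by (rule prox_is_arg_min[OF assms])
    also have "f ((1 - t) *\<^sub>R p + t *\<^sub>R z) \<le> (1 - t) * f p + t * f z"
      using convex_onD[OF assms(1), of t p z] t by simp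
    also have "(1 - t) *\<^sub>R p + t *\<^sub>R z - w = (p - w) + t *\<^sub>R e"
      by (simp add: e_def algebra_simps)
    also have "(norm ((p - w) + t *\<^sub>R e))\<^sup>2
        = (norm (p - w))\<^sup>2 - 2 * t * ((w - p) \<bullet> e) + t * t * (norm e)\<^sup>2"
      unfolding power2_norm_eq_inner by (simp add: inner_simps inner_commute algebra_simps)
    finally have "0 \<le> t * (f z - f p - (w - p) \<bullet> e + t * ((norm e)\<^sup>2 / 2))"
      by (simp add: algebra_simps)
    then show ?thesis
      using t by (simp add: zero_le_mult_iff)
  qed
  have "((\<lambda>t. f z - f p - (w - p) \<bullet> e + t * ((norm e)\<^sup>2 / 2))
      \<longlongrightarrow> f z - f p - (w - p) \<bullet> e + 0 * ((norm e)\<^sup>2 / 2)) (at_right 0)"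
    by (intro tendsto_intros)
  then have "0 \<le> f z - f p - (w - p) \<bullet> e + 0 * ((norm e)\<^sup>2 / 2)"
    by (rule tendsto_lowerbound)
       (use ineq in \<open>auto simp: eventually_at_right[of 0 1] intro!: exI[of _ 1]\<close>)
  then show ?thesis
    by (simp add: e_def p_def)
qed

section \<open>The minimum norm minimiser\<close>

lemma min_norm_minimiser:
  fixes f :: "'a::{real_inner, complete_space} \<Rightarrow> real"
  assumes convex: "convex_on UNIV f" and cont: "continuous_on UNIV f" and min: "\<And>u. f z0 \<le> f u"
  obtains p where "\<And>u. f p \<le> f u"
    and "\<And>u. f u = f p \<Longrightarrow> norm p \<le> norm u"
    and "\<And>\<epsilon>. \<epsilon> > 0 \<Longrightarrow> \<exists>\<eta>>0. \<forall>w. f w \<le> f p + \<eta> \<longrightarrow> (norm p)\<^sup>2 - \<epsilon> < (norm w)\<^sup>2"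
proof -
  define S where "S n = {u. f u \<le> f z0 + inverse (real (Suc n))}" for n
  obtain p where pS: "\<And>n. p \<in> S n"
    and p: "\<And>\<epsilon>. \<epsilon> > 0 \<Longrightarrow> \<exists>n. \<forall>w\<in>S n. (norm p)\<^sup>2 - \<epsilon> < (norm w)\<^sup>2"
  proof (rule nested_strongly_convex_minimum[of "\<lambda>u. (norm u)\<^sup>2" "1/4" 0 S z0])
    show "(norm (midpoint u v))\<^sup>2 \<le> ((norm u)\<^sup>2 + (norm v)\<^sup>2) / 2 - 1 / 4 * (norm (u - v))\<^sup>2"
      for u v :: 'a
      using norm_midpoint_sq[of u v 0] by simp
    show "continuous_on UNIV (\<lambda>u::'a. (norm u)\<^sup>2)"
      by (intro continuous_intros)
    show "closed (S n)" for n
      unfolding S_def by (intro closed_Collect_le cont continuous_intros)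
    show "decseq S"
    proof (intro decseq_SucI subsetI)
      fix n u
      assume "u \<in> S (Suc n)"
      moreover have "inverse (real (Suc (Suc n))) \<le> inverse (real (Suc n))"
        by (intro le_imp_inverse_le) auto
      ultimately show "u \<in> S n"
        unfolding S_def mem_Collect_eq by linarith
    qed
    show "midpoint u v \<in> S n" if "u \<in> S n" "v \<in> S n" for u v n
      using that convex_on_midpoint[OF convex, of u v] by (auto simp: S_def)
  qed (auto simp: S_def)
  have "(\<lambda>n. f z0 + inverse (real (Suc n))) \<longlonglongrightarrow> f z0 + 0"
    by (intro tendsto_intros LIMSEQ_inverse_real_of_nat)
  then have "f p \<le> f z0 + 0"
    by (rule LIMSEQ_le_const) (use pS in \<open>auto simp: S_def\<close>)
  with min[of p] have fp: "f p = f z0"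
    by simp
  show ?thesis
  proof
    show "f p \<le> f u" for u
      using min[of u] fp by simp
    show "norm p \<le> norm u" if "f u = f p" for u
    proof -
      have "u \<in> S n" for n
        using that fp by (simp add: S_def)
      then have "(norm p)\<^sup>2 \<le> (norm u)\<^sup>2 + \<epsilon>" if "\<epsilon> > 0" for \<epsilon>
        using p[OF that] by fastforce
      then have "(norm p)\<^sup>2 \<le> (norm u)\<^sup>2"
        by (rule field_le_epsilon)
      then show ?thesis
        by simp
    qed
    show "\<exists>\<eta>>0. \<forall>w. f w \<le> f p + \<eta> \<longrightarrow> (norm p)\<^sup>2 - \<epsilon> < (norm w)\<^sup>2" if "\<epsilon> > 0" for \<epsilon>
    proof -
      obtain n where "\<forall>w\<in>S n. (norm p)\<^sup>2 - \<epsilon> < (norm w)\<^sup>2"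
        using p[OF \<open>\<epsilon> > 0\<close>] by blast
      then show ?thesis
        by (intro exI[of _ "inverse (real (Suc n))"]) (auto simp: S_def fp)
    qed
  qed
qed

text \<open>
  The point picked by the choice operator has the same value and norm as the one constructed above, and
  the estimate depends on \<open>p\<close> only through these two numbers.
\<close>

lemma arg_min_on_norm_argmin_set:
  fixes f :: "'a::{real_inner, complete_space} \<Rightarrow> real"
  assumes convex: "convex_on UNIV f" and cont: "continuous_on UNIV f"
    and "argmin_set f \<noteq> {}" and p_def: "p = arg_min_on norm (argmin_set f)"
  shows "f p \<le> f u"
    and "\<epsilon> > 0 \<Longrightarrow> \<exists>\<eta>>0. \<forall>w. f w \<le> f p + \<eta> \<longrightarrow> (norm p)\<^sup>2 - \<epsilon> < (norm w)\<^sup>2"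
proof -
  obtain z0 where "\<And>u. f z0 \<le> f u"
    using assms(3) unfolding argmin_set_def is_arg_min_def by (auto simp: not_less)
  with convex cont obtain q where q: "\<And>u. f q \<le> f u" "\<And>u. f u = f q \<Longrightarrow> norm q \<le> norm u"
    "\<And>\<epsilon>. \<epsilon> > 0 \<Longrightarrow> \<exists>\<eta>>0. \<forall>w. f w \<le> f q + \<eta> \<longrightarrow> (norm q)\<^sup>2 - \<epsilon> < (norm w)\<^sup>2"
    by (rule min_norm_minimiser) blast
  have in_argmin: "u \<in> argmin_set f \<longleftrightarrow> f u = f q" for u
    unfolding argmin_set_def is_arg_min_def using q(1) by (auto simp: not_less intro: antisym)
  have "is_arg_min norm (\<lambda>u. u \<in> argmin_set f) q"
    unfolding is_arg_min_def in_argmin using q(2) by (auto simp: not_less)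
  then have "is_arg_min norm (\<lambda>u. u \<in> argmin_set f) p"
    unfolding p_def arg_min_on_def arg_min_def by (rule someI)
  then have "f p = f q" "norm p \<le> norm q"
    unfolding is_arg_min_def in_argmin by (auto simp: not_less)
  with q(2)[of p] have "norm p = norm q"
    by simp
  with \<open>f p = f q\<close> q(1,3)
  show "f p \<le> f u" and "\<epsilon> > 0 \<Longrightarrow> \<exists>\<eta>>0. \<forall>w. f w \<le> f p + \<eta> \<longrightarrow> (norm p)\<^sup>2 - \<epsilon> < (norm w)\<^sup>2"
    by simp_all
qed

text \<open>
  The midpoint of \<open>w i\<close> and \<open>p\<close> has almost minimal value, hence almost at least the norm of
  \<open>p\<close>; as \<open>w i\<close> is no longer than \<open>p\<close>, the parallelogram law leaves no room between them.
\<close>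

lemma minimising_sequence_in_ball_tendsto:
  fixes f :: "'a::real_inner \<Rightarrow> real"
  assumes convex: "convex_on UNIV f"
    and p: "\<And>\<epsilon>. \<epsilon> > 0 \<Longrightarrow> \<exists>\<eta>>0. \<forall>w. f w \<le> f p + \<eta> \<longrightarrow> (norm p)\<^sup>2 - \<epsilon> < (norm w)\<^sup>2"
    and f_lim: "((\<lambda>i. f (w i)) \<longlongrightarrow> f p) F"
    and ball: "\<forall>\<^sub>F i in F. norm (w i) \<le> norm p"
  shows "(w \<longlongrightarrow> p) F"
proof (rule tendstoI)
  fix e :: real
  assume "e > 0"
  then have "e\<^sup>2 / 4 > 0"
    by simp
  then obtain \<eta> where "\<eta> > 0" and \<eta>: "\<And>u. f u \<le> f p + \<eta> \<Longrightarrow> (norm p)\<^sup>2 - e\<^sup>2 / 4 < (norm u)\<^sup>2"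
    using p by blast
  have "\<forall>\<^sub>F i in F. f (w i) < f p + \<eta>"
    using order_tendstoD(2)[OF f_lim, of "f p + \<eta>"] \<open>\<eta> > 0\<close> by simp
  with ball show "\<forall>\<^sub>F i in F. dist (w i) p < e"
  proof eventually_elim
    case (elim i)
    have "f (midpoint (w i) p) \<le> f p + \<eta>"
      using convex_on_midpoint[OF convex, of "w i" p] elim(2) \<open>\<eta> > 0\<close> by argo
    from \<eta>[OF this] have "(norm p)\<^sup>2 - e\<^sup>2 / 4 < ((norm (w i))\<^sup>2 + (norm p)\<^sup>2) / 2 - (norm (w i - p))\<^sup>2 / 4"
      using norm_midpoint_sq[of "w i" p 0] by simp
    moreover have "(norm (w i))\<^sup>2 \<le> (norm p)\<^sup>2"
      using elim(1) by (intro power_mono) auto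
    ultimately have "(norm (w i - p))\<^sup>2 < e\<^sup>2"
      by argo
    then show ?case
      using \<open>e > 0\<close> by (auto simp: dist_norm intro: power_less_imp_less_base)
  qed
qed

section \<open>A discrete Gronwall argument\<close>

text \<open>
  The hypothesis discretises \<open>z' \<le> -\<delta> z\<close> with time steps \<open>1/k\<close>, whose sum diverges. While \<open>z\<close>
  exceeds \<open>\<epsilon>\<close> it loses at least \<open>\<delta>\<epsilon>/k\<close> per step, so divergence of the harmonic series
  brings it below \<open>\<epsilon>\<close>, and it cannot increase to a positive value.
\<close>

lemma logarithmic_decay_eventually_le:
  fixes z :: "nat \<Rightarrow> real"
  assumes "\<delta> > 0" and "\<epsilon> > 0"
    and decay: "\<forall>\<^sub>F k in sequentially. real k * (z (Suc k) - z k) \<le> - \<delta> * z (Suc k)"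
  shows "\<forall>\<^sub>F k in sequentially. z k \<le> \<epsilon>"
proof -
  obtain N where "N \<ge> 1" and N: "\<And>k. k \<ge> N \<Longrightarrow> real k * (z (Suc k) - z k) \<le> - \<delta> * z (Suc k)"
    using decay unfolding eventually_sequentially
    by (metis max.bounded_iff nle_le)
  have "\<exists>K\<ge>N. z K \<le> \<epsilon>"
  proof (rule ccontr)
    assume "\<not> ?thesis"
    then have big: "\<epsilon> < z k" if "k \<ge> N" for k
      using that by force
    have drop: "\<delta> * \<epsilon> * inverse (real k) \<le> z k - z (Suc k)" if "k \<ge> N" for k
    proof -
      have "\<delta> * \<epsilon> \<le> \<delta> * z (Suc k)"
        using big[of "Suc k"] that \<open>\<delta> > 0\<close> by simp
      with N[OF that] have "\<delta> * \<epsilon> \<le> real k * (z k - z (Suc k))"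
        by (simp add: algebra_simps)
      then show ?thesis
        using that \<open>N \<ge> 1\<close> by (simp add: field_simps)
    qed
    have partial: "(\<Sum>k<n. \<delta> * \<epsilon> * inverse (real (k + N))) \<le> z N" for n
    proof -
      have "(\<Sum>k<n. \<delta> * \<epsilon> * inverse (real (k + N))) \<le> (\<Sum>k<n. z (k + N) - z (Suc k + N))"
      proof (rule sum_mono)
        show "\<delta> * \<epsilon> * inverse (real (k + N)) \<le> z (k + N) - z (Suc k + N)" for k
          using drop[of "k + N"] by simp
      qed
      also have "\<dots> = z N - z (n + N)"
        by (induction n) auto
      also have "\<dots> \<le> z N"
        using big[of "n + N"] \<open>\<epsilon> > 0\<close> by simp
      finally show ?thesis .
    qed
    have "summable (\<lambda>k. \<delta> * \<epsilon> * inverse (real (k + N)))"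
      by (rule summableI_nonneg_bounded[OF _ partial]) (use assms(1,2) in auto)
    then have "summable (\<lambda>k. inverse (real (k + N)))"
      using assms(1,2) by (subst (asm) summable_cmult_iff) auto
    then have "summable (\<lambda>k. inverse (real k))"
      using summable_iff_shift[of "\<lambda>k. inverse (real k)" N] by simp
    then show False
      using not_summable_harmonic[where 'a = real] by (simp add: inverse_eq_divide)
  qed
  then obtain K where "K \<ge> N" "z K \<le> \<epsilon>"
    by blast
  have "z k \<le> \<epsilon>" if "k \<ge> K" for k
    using that
  proof (induction k rule: dec_induct)
    case (step k)
    show ?case
    proof (rule ccontr)
      assume "\<not> z (Suc k) \<le> \<epsilon>"
      then have "\<delta> * z (Suc k) > 0" "real k * (z (Suc k) - z k) \<ge> 0"
        using step.IH assms(1,2) by (auto intro!: mult_pos_pos)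
      then show False
        using N[of k] step \<open>K \<ge> N\<close> by auto
    qed
  qed (use \<open>z K \<le> \<epsilon>\<close> in simp)
  then show ?thesis
    unfolding eventually_sequentially by blast
qed

section \<open>The Lyapunov energy\<close>

text \<open>
  The assumption \<open>step\<close> is the subgradient inequality for the proximal step, with the extrapolated
  and Tikhonov-shifted point written out.
\<close>

locale inertial_tikhonov_prox =
  fixes f :: "'a::real_inner \<Rightarrow> real" and c \<alpha> :: real and x :: "nat \<Rightarrow> 'a" and p :: 'a
  assumes c_pos: "c > 0" and alpha_gt: "\<alpha> > 3"
    and minimiser: "\<And>u. f p \<le> f u"
    and step: "\<And>k u. k \<ge> 1 \<Longrightarrow>
      f (x (Suc k)) + (x k + (1 - \<alpha> / real k) *\<^sub>R (x k - x (k - 1)) - (c / (real k)\<^sup>2) *\<^sub>R x k - x (Suc k))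
        \<bullet> (u - x (Suc k)) \<le> f u"
begin

text \<open>
  The weight \<open>b\<close> is the midpoint of the admissible interval from \<open>2\<close> to \<open>\<alpha>-1\<close>, which is nonempty
  exactly when \<open>\<alpha> > 3\<close>. Both gaps then equal \<open>a\<close>: the one to \<open>\<alpha>-1\<close> makes the kinetic term decay,
  and the one to \<open>2\<close> makes the potential term decay despite its growing factor.
\<close>

definition a :: real where "a = (\<alpha> - 3) / 2"

definition b :: real where "b = (\<alpha> + 1) / 2"

text \<open>
  The momentum carries the factor \<open>k-\<alpha>\<close> because multiplying the iteration by \<open>k\<close> then gives its
  increment as \<open>(1-\<alpha>) (x (k+1) - x k) - (c/k) x k - k g\<close>, in which only the new difference and the
  subgradient \<open>g\<close> at \<open>x (k+1)\<close> occur. The factors of the last two terms make them compensate the products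
  of \<open>g\<close> and of \<open>x k\<close> with \<open>x (k+1) - x k\<close>: the first by the subgradient inequality, the second up to a
  drift of the factor by \<open>c(\<alpha>-1)/(2k(k+1))\<close>.
\<close>

definition energy :: "real \<Rightarrow> nat \<Rightarrow> real" where
  "energy s k =
     (norm (b *\<^sub>R (x k - p) + (real k - \<alpha>) *\<^sub>R (x k - x (k - 1))))\<^sup>2 / 2
     + a * b / 2 * (norm (x k - p))\<^sup>2
     + real k * (real k + 1 - \<alpha>) * (f (x k) - f p)
     + c * (real k + 1 - \<alpha>) / (2 * real k) * ((norm (x k))\<^sup>2 - s)"

lemma a_pos: "a > 0" and b_gt: "b > 2" and alpha_eq: "\<alpha> = a + b + 1" and b_eq: "b = a + 2"
  using alpha_gt by (auto simp: a_def b_def field_simps)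

text \<open>
  The Tikhonov term contributes \<open>-(cb/k) \<langle>x k, x (k+1) - p\<rangle>\<close> to the increment of the energy, and
  polarisation makes \<open>\<langle>x (k+1), x (k+1) - p\<rangle>\<close> half of \<open>|x (k+1) - p|\<^sup>2 + |x (k+1)|\<^sup>2 - |p|\<^sup>2\<close>. The
  difference of the last two terms is \<open>Q - (|p|\<^sup>2 - s)\<close>, which explains the constant term.
\<close>

lemma energy_step:
  fixes s :: real
  assumes k: "k \<ge> 1" "real k \<ge> \<alpha>"
  defines "\<tau> \<equiv> real k + 1 - \<alpha>" and "Q \<equiv> (norm (x (Suc k)))\<^sup>2 - s"
  shows "real k * (energy s (Suc k) - energy s k) \<le>
      - (a * \<tau> * real k - c * \<tau> / 2 - c * b) * (norm (x (Suc k) - x k))\<^sup>2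
      - a * (real k)\<^sup>2 * (f (x (Suc k)) - f p)
      - c * b / 4 * (norm (x (Suc k) - p))\<^sup>2
      - (c * b / 2 - c * (\<alpha> - 1) / (2 * (real k + 1))) * Q
      + c * b / 2 * ((norm p)\<^sup>2 - s)"
proof -
  define u D q where "u = x k" and "D = x (Suc k) - x k" and "q = x (Suc k) - p"
  define \<kappa> where "\<kappa> = real k"
  define g where "g = x k + (1 - \<alpha> / \<kappa>) *\<^sub>R (x k - x (k - 1)) - (c / \<kappa>\<^sup>2) *\<^sub>R x k - x (Suc k)"
  define F0 F1 where "F0 = f (x k) - f p" and "F1 = f (x (Suc k)) - f p"
  define \<eta>0 where "\<eta>0 = b *\<^sub>R (x k - p) + (\<kappa> - \<alpha>) *\<^sub>R (x k - x (k - 1))"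
  define \<eta>1 where "\<eta>1 = b *\<^sub>R q + \<tau> *\<^sub>R D"
  have \<kappa>: "\<kappa> \<ge> 1" "\<tau> \<ge> 1"
    using k by (auto simp: \<kappa>_def \<tau>_def)
  have ab: "a > 0" "b > 2" "\<alpha> = a + b + 1" "b = a + 2"
    using a_pos b_gt alpha_eq b_eq by auto
  have gq: "F1 \<le> g \<bullet> q"
    using step[OF k(1), of p] by (simp add: F1_def g_def \<kappa>_def q_def inner_diff_right)
  have gD: "F1 - F0 \<le> g \<bullet> D"
    using step[OF k(1), of "x k"] by (simp add: F1_def F0_def g_def \<kappa>_def D_def inner_diff_right)
  have mom: "(\<kappa> - \<alpha>) *\<^sub>R (x k - x (k - 1)) = \<kappa> *\<^sub>R (D + g) + (c / \<kappa>) *\<^sub>R u"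
  proof -
    have "\<kappa> *\<^sub>R (D + g) + (c / \<kappa>) *\<^sub>R u
        = (\<kappa> * (1 - \<alpha> / \<kappa>)) *\<^sub>R (x k - x (k - 1)) + (c / \<kappa> - \<kappa> * (c / \<kappa>\<^sup>2)) *\<^sub>R u"
      by (simp add: D_def g_def u_def algebra_simps)
    also have "\<kappa> * (1 - \<alpha> / \<kappa>) = \<kappa> - \<alpha>"
      using \<kappa> by (simp add: field_simps)
    also have "c / \<kappa> - \<kappa> * (c / \<kappa>\<^sup>2) = 0"
      using \<kappa> by (simp add: power2_eq_square)
    finally show ?thesis by simp
  qed
  have diff: "\<eta>1 - \<eta>0 = - (a *\<^sub>R D + \<kappa> *\<^sub>R g + (c / \<kappa>) *\<^sub>R u)"
  proof -
    have xp: "x k - p = q - D"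
      by (simp add: q_def D_def)
    have "\<eta>1 - \<eta>0 = (b + \<tau> - \<kappa>) *\<^sub>R D - \<kappa> *\<^sub>R g - (c / \<kappa>) *\<^sub>R u"
      unfolding \<eta>0_def \<eta>1_def mom xp by (simp add: algebra_simps)
    also have "b + \<tau> - \<kappa> = - a"
      using ab by (simp add: \<tau>_def \<kappa>_def)
    finally show ?thesis
      by simp
  qed
  \<comment> \<open>Expanding the square around the new point \<open>\<eta>1\<close> leaves a quadratic remainder of favourable sign.\<close>
  have A: "(norm \<eta>1)\<^sup>2 / 2 - (norm \<eta>0)\<^sup>2 / 2 \<le>
      - a * b * (D \<bullet> q) - a * \<tau> * (D \<bullet> D) - c * b / \<kappa> * (u \<bullet> q) - c * \<tau> / \<kappa> * (u \<bullet> D)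
      - \<kappa> * b * (g \<bullet> q) - \<kappa> * \<tau> * (g \<bullet> D)"
  proof -
    have "(norm \<eta>1)\<^sup>2 / 2 - (norm \<eta>0)\<^sup>2 / 2 = (\<eta>1 - \<eta>0) \<bullet> \<eta>1 - (norm (\<eta>1 - \<eta>0))\<^sup>2 / 2"
      unfolding power2_norm_eq_inner by (simp add: inner_simps inner_commute field_simps)
    also have "\<dots> \<le> (\<eta>1 - \<eta>0) \<bullet> \<eta>1"
      by simp
    also have "\<dots> = - a * b * (D \<bullet> q) - a * \<tau> * (D \<bullet> D) - c * b / \<kappa> * (u \<bullet> q) - c * \<tau> / \<kappa> * (u \<bullet> D)
      - \<kappa> * b * (g \<bullet> q) - \<kappa> * \<tau> * (g \<bullet> D)"
      unfolding diff unfolding \<eta>1_def by (simp add: inner_simps algebra_simps)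
    finally show ?thesis .
  qed
  have B: "(norm (x k - p))\<^sup>2 = q \<bullet> q - 2 * (D \<bullet> q) + D \<bullet> D"
    unfolding power2_norm_eq_inner q_def D_def by (simp add: inner_simps inner_commute)
  have C: "(norm u)\<^sup>2 = (norm (x (Suc k)))\<^sup>2 - 2 * (u \<bullet> D) - D \<bullet> D"
    unfolding power2_norm_eq_inner u_def D_def by (simp add: inner_simps inner_commute)
  have uq: "u \<bullet> q = (q \<bullet> q + (norm (x (Suc k)))\<^sup>2 - (norm p)\<^sup>2) / 2 - D \<bullet> q"
    unfolding power2_norm_eq_inner u_def D_def q_def
    by (simp add: inner_simps inner_commute field_simps)
  \<comment> \<open>This weighting spends half of the available decrease in \<open>q \<bullet> q\<close>.\<close>
  have Dq: "D \<bullet> q \<le> D \<bullet> D + q \<bullet> q / 4"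
  proof -
    have "0 \<le> (D - (1/2) *\<^sub>R q) \<bullet> (D - (1/2) *\<^sub>R q)"
      by simp
    then show ?thesis
      by (simp add: inner_simps inner_commute)
  qed
  have E0: "energy s k = (norm \<eta>0)\<^sup>2 / 2 + a * b / 2 * (q \<bullet> q - 2 * (D \<bullet> q) + D \<bullet> D)
      + \<kappa> * \<tau> * F0 + c * \<tau> / (2 * \<kappa>) * (Q - 2 * (u \<bullet> D) - D \<bullet> D)"
    unfolding energy_def B[symmetric] using C by (simp add: \<eta>0_def \<kappa>_def \<tau>_def F0_def Q_def u_def)
  have E1: "energy s (Suc k) = (norm \<eta>1)\<^sup>2 / 2 + a * b / 2 * (q \<bullet> q)
      + (\<kappa> + 1) * (\<tau> + 1) * F1 + c * (\<tau> + 1) / (2 * (\<kappa> + 1)) * Q"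
    unfolding energy_def \<eta>1_def
    by (simp add: \<kappa>_def \<tau>_def F1_def Q_def D_def q_def power2_norm_eq_inner algebra_simps)
  have "F1 \<ge> 0"
    using minimiser by (simp add: F1_def)
  have gq': "\<kappa> * b * F1 \<le> \<kappa> * b * (g \<bullet> q)"
    using gq \<kappa> ab by (intro mult_left_mono) auto
  have gD': "\<kappa> * \<tau> * (F1 - F0) \<le> \<kappa> * \<tau> * (g \<bullet> D)"
    using gD \<kappa> by (intro mult_left_mono) auto
  have Dq': "c * b / \<kappa> * (D \<bullet> q) \<le> c * b / \<kappa> * (D \<bullet> D + q \<bullet> q / 4)"
    using Dq c_pos ab \<kappa> by (intro mult_left_mono) auto
  have coefQ: "c * (\<tau> + 1) / (2 * (\<kappa> + 1)) = c * \<tau> / (2 * \<kappa>) + c * (\<alpha> - 1) / (2 * (\<kappa> + 1)) / \<kappa>"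
  proof -
    have "\<tau> = \<kappa> - (\<alpha> - 1)"
      by (simp add: \<tau>_def \<kappa>_def)
    then show ?thesis
      using \<kappa> by (simp add: divide_simps) (simp add: algebra_simps)
  qed
  have coefF: "\<kappa> * b + \<kappa> * \<tau> - (\<kappa> + 1) * (\<tau> + 1) = a * \<kappa> + (\<alpha> - 2)"
    using ab by (simp add: \<tau>_def \<kappa>_def algebra_simps)
  have E: "energy s (Suc k) - energy s k \<le>
      - (a * \<tau> + a * b / 2 - c * \<tau> / (2 * \<kappa>) - c * b / \<kappa>) * (D \<bullet> D) - (a * \<kappa> + (\<alpha> - 2)) * F1
      - c * b / \<kappa> / 4 * (q \<bullet> q) - c * b / \<kappa> / 2 * (Q - ((norm p)\<^sup>2 - s))
      + c * (\<alpha> - 1) / (2 * (\<kappa> + 1)) / \<kappa> * Q"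
  proof -
    have uq': "c * b / \<kappa> * (u \<bullet> q) = c * b / \<kappa> / 2 * (q \<bullet> q) + c * b / \<kappa> / 2 * (Q - ((norm p)\<^sup>2 - s)) - c * b / \<kappa> * (D \<bullet> q)"
      unfolding uq Q_def by (simp add: algebra_simps add_divide_distrib diff_divide_distrib)
    have X: "c * \<tau> / (2 * \<kappa>) * (Q - 2 * (u \<bullet> D) - D \<bullet> D)
       = c * \<tau> / (2 * \<kappa>) * Q - c * \<tau> / \<kappa> * (u \<bullet> D) - c * \<tau> / (2 * \<kappa>) * (D \<bullet> D)"
      by (simp add: right_diff_distrib)
    have Y: "c * b / \<kappa> * (D \<bullet> D + q \<bullet> q / 4) = c * b / \<kappa> * (D \<bullet> D) + c * b / \<kappa> / 4 * (q \<bullet> q)"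
      "c * b / \<kappa> / 2 * (q \<bullet> q) = 2 * (c * b / \<kappa> / 4 * (q \<bullet> q))"
      by (simp_all add: distrib_left)
    have Z: "(a * \<kappa> + (\<alpha> - 2)) * F1 = \<kappa> * b * F1 + \<kappa> * \<tau> * F1 - (\<kappa> + 1) * (\<tau> + 1) * F1"
      unfolding coefF[symmetric] by (simp add: algebra_simps)
    have V: "c * (\<tau> + 1) / (2 * (\<kappa> + 1)) * Q = c * \<tau> / (2 * \<kappa>) * Q + c * (\<alpha> - 1) / (2 * (\<kappa> + 1)) / \<kappa> * Q"
      unfolding coefQ by (rule distrib_right)
    have U: "a * b / 2 * (q \<bullet> q - 2 * (D \<bullet> q) + D \<bullet> D) = a * b / 2 * (q \<bullet> q) - a * b * (D \<bullet> q) + a * b / 2 * (D \<bullet> D)"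
      by (simp add: algebra_simps)
    have T: "(a * \<tau> + a * b / 2 - c * \<tau> / (2 * \<kappa>) - c * b / \<kappa>) * (D \<bullet> D)
       = a * \<tau> * (D \<bullet> D) + a * b / 2 * (D \<bullet> D) - c * \<tau> / (2 * \<kappa>) * (D \<bullet> D) - c * b / \<kappa> * (D \<bullet> D)"
      by (simp add: left_diff_distrib distrib_right)
    have W: "\<kappa> * \<tau> * (F1 - F0) = \<kappa> * \<tau> * F1 - \<kappa> * \<tau> * F0"
      by (rule right_diff_distrib)
    show ?thesis
      using A uq' Dq' gq' gD' T unfolding E0 E1 X Y Z V U W by linarith
  qed
  have "\<kappa> * (energy s (Suc k) - energy s k) \<le>
      \<kappa> * (- (a * \<tau> + a * b / 2 - c * \<tau> / (2 * \<kappa>) - c * b / \<kappa>) * (D \<bullet> D) - (a * \<kappa> + (\<alpha> - 2)) * F1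
      - c * b / \<kappa> / 4 * (q \<bullet> q) - c * b / \<kappa> / 2 * (Q - ((norm p)\<^sup>2 - s))
      + c * (\<alpha> - 1) / (2 * (\<kappa> + 1)) / \<kappa> * Q)"
    using E \<kappa> by (intro mult_left_mono) auto
  also have "\<dots> = - (a * \<tau> * \<kappa> - c * \<tau> / 2 - c * b) * (D \<bullet> D) - a * \<kappa>\<^sup>2 * F1
      - c * b / 4 * (q \<bullet> q) - (c * b / 2 - c * (\<alpha> - 1) / (2 * (\<kappa> + 1))) * Q + c * b / 2 * ((norm p)\<^sup>2 - s)
      - (\<kappa> * (a * b / 2) * (D \<bullet> D) + \<kappa> * (\<alpha> - 2) * F1)"
  proof -
    have dist: "\<kappa> * (- A * B - C - d - e + h)
        = - (\<kappa> * (A * B)) - \<kappa> * C - \<kappa> * d - \<kappa> * e + \<kappa> * h" for A B C d e h :: real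
      by (simp add: algebra_simps)
    have "\<kappa> * (a * \<tau> + a * b / 2 - c * \<tau> / (2 * \<kappa>) - c * b / \<kappa>)
        = (a * \<tau> * \<kappa> - c * \<tau> / 2 - c * b) + \<kappa> * (a * b / 2)"
      using \<kappa> by (simp add: right_diff_distrib distrib_left)
    then have "\<kappa> * ((a * \<tau> + a * b / 2 - c * \<tau> / (2 * \<kappa>) - c * b / \<kappa>) * (D \<bullet> D))
        = (a * \<tau> * \<kappa> - c * \<tau> / 2 - c * b) * (D \<bullet> D) + \<kappa> * (a * b / 2) * (D \<bullet> D)"
      by (simp only: mult.assoc[symmetric] distrib_right)
    moreover have "\<kappa> * ((a * \<kappa> + (\<alpha> - 2)) * F1) = a * \<kappa>\<^sup>2 * F1 + \<kappa> * (\<alpha> - 2) * F1"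
      by (simp add: power2_eq_square algebra_simps)
    moreover have "\<kappa> * (c * b / \<kappa> / 4 * (q \<bullet> q)) = c * b / 4 * (q \<bullet> q)"
      "\<kappa> * (c * b / \<kappa> / 2 * (Q - ((norm p)\<^sup>2 - s))) = c * b / 2 * Q - c * b / 2 * ((norm p)\<^sup>2 - s)"
      "\<kappa> * (c * (\<alpha> - 1) / (2 * (\<kappa> + 1)) / \<kappa> * Q) = c * (\<alpha> - 1) / (2 * (\<kappa> + 1)) * Q"
      using \<kappa> by (simp_all add: right_diff_distrib)
    ultimately show ?thesis
      unfolding dist unfolding left_diff_distrib[of "c * b / 2" _ Q] mult_minus_left by linarith
  qed
  also have "\<dots> \<le> - (a * \<tau> * \<kappa> - c * \<tau> / 2 - c * b) * (D \<bullet> D) - a * \<kappa>\<^sup>2 * F1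
      - c * b / 4 * (q \<bullet> q) - (c * b / 2 - c * (\<alpha> - 1) / (2 * (\<kappa> + 1))) * Q + c * b / 2 * ((norm p)\<^sup>2 - s)"
  proof -
    have "0 \<le> \<kappa> * (a * b / 2) * (D \<bullet> D)" "0 \<le> \<kappa> * (\<alpha> - 2) * F1"
      using \<kappa> ab(1,2) \<open>F1 \<ge> 0\<close> alpha_gt by (auto intro!: mult_nonneg_nonneg)
    then show ?thesis
      by linarith
  qed
  finally show ?thesis
    unfolding \<kappa>_def D_def q_def F1_def power2_norm_eq_inner .
qed

text \<open>
  The two entries bound the decay rates of the terms with \<open>x (k+1) - x k\<close> and with \<open>x (k+1) - p\<close>. The
  rates \<open>a\<close> of the potential and \<open>b/2\<close> of the Tikhonov term are larger than \<open>a/2\<close>.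
\<close>

definition \<delta> :: real where "\<delta> = min (a / 2) (c * b / (4 * (b\<^sup>2 + a * b / 2)))"

lemma delta_pos: "\<delta> > 0"
  unfolding \<delta>_def using a_pos b_gt c_pos by (auto intro!: divide_pos_pos add_pos_pos)

text \<open>
  Each summand of the energy at the new point is matched with a summand of the decrease. The hypothesis
  on \<open>s\<close> is what makes the Tikhonov summand nonnegative, so that it can be estimated termwise.
\<close>

lemma energy_decay:
  assumes s: "\<forall>\<^sub>F k in sequentially. s \<le> (norm (x k))\<^sup>2"
  shows "\<forall>\<^sub>F k in sequentially. real k * (energy s (Suc k) - energy s k)
    \<le> - \<delta> * energy s (Suc k) + c * b / 2 * ((norm p)\<^sup>2 - s)"
proof -
  \<comment> \<open>The last two entries let the kinetic decrease absorb its lower order errors and let the decrease of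
    the Tikhonov term absorb the drift of its factor in \<open>energy\<close>.\<close>
  define K where "K = max (max 1 \<alpha>) (max ((c + 2 * c * b) / a) (2 * (\<alpha> - 1) / b))"
  have "\<forall>\<^sub>F k in sequentially. s \<le> (norm (x (Suc k)))\<^sup>2"
    using s by (simp add: eventually_sequentially_Suc[of "\<lambda>k. s \<le> (norm (x k))\<^sup>2"])
  moreover have "\<forall>\<^sub>F k in sequentially. K \<le> real k"
    using filterlim_real_sequentially unfolding filterlim_at_top by blast
  ultimately show ?thesis
  proof eventually_elim
    case (elim k)
    define \<kappa> \<tau> Q where "\<kappa> = real k" and "\<tau> = real k + 1 - \<alpha>" and "Q = (norm (x (Suc k)))\<^sup>2 - s"
    define DD qq F where "DD = (norm (x (Suc k) - x k))\<^sup>2" and "qq = (norm (x (Suc k) - p))\<^sup>2"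
      and "F = f (x (Suc k)) - f p"
    have ab: "a > 0" "b > 2" "\<alpha> = a + b + 1" "b = a + 2"
      using a_pos b_gt alpha_eq b_eq by auto
    have nonneg: "Q \<ge> 0" "DD \<ge> 0" "qq \<ge> 0" "F \<ge> 0"
      using elim minimiser by (auto simp: Q_def DD_def qq_def F_def)
    have K: "\<kappa> \<ge> 1" "\<kappa> \<ge> \<alpha>" "(c + 2 * c * b) / a \<le> \<kappa>" "2 * (\<alpha> - 1) / b \<le> \<kappa>"
      using elim(2) by (auto simp: K_def \<kappa>_def)
    have \<tau>: "\<tau> \<ge> 1" "\<tau> \<le> \<kappa>" "\<tau> + 1 \<le> \<kappa> - 1"
      using K alpha_gt by (auto simp: \<kappa>_def \<tau>_def)
    have K': "c + 2 * c * b \<le> a * \<kappa>" "2 * (\<alpha> - 1) \<le> b * \<kappa>"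
      using K ab by (auto simp: field_simps)
    have coefD: "a / 2 * \<tau>\<^sup>2 \<le> a * \<tau> * \<kappa> - c * \<tau> / 2 - c * b"
    proof -
      have "\<tau> * (c + 2 * c * b) \<le> \<tau> * (a * \<kappa>)"
        using K' \<tau> by (intro mult_left_mono) auto
      moreover have "2 * c * b \<le> \<tau> * (2 * c * b)"
        using \<tau> c_pos ab mult_right_mono[of 1 \<tau> "2 * c * b"] by simp
      moreover have "a * \<tau> * \<tau> \<le> a * \<tau> * \<kappa>"
        using \<tau> ab by (intro mult_left_mono) auto
      ultimately show ?thesis
        by (simp add: power2_eq_square algebra_simps)
    qed
    have coefQ: "c * b / 4 \<le> c * b / 2 - c * (\<alpha> - 1) / (2 * (\<kappa> + 1))"
    proof -
      have "c * (2 * (\<alpha> - 1)) \<le> c * (b * (\<kappa> + 1))"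
        using K' ab c_pos by (intro mult_left_mono) (auto simp: algebra_simps)
      then show ?thesis
        using K(1) by (simp add: field_simps)
    qed
    have "real k * (energy s (Suc k) - energy s k) \<le>
      - (a * \<tau> * \<kappa> - c * \<tau> / 2 - c * b) * DD - a * \<kappa>\<^sup>2 * F - c * b / 4 * qq
      - (c * b / 2 - c * (\<alpha> - 1) / (2 * (\<kappa> + 1))) * Q + c * b / 2 * ((norm p)\<^sup>2 - s)"
      using energy_step[of k s] K unfolding \<kappa>_def \<tau>_def Q_def DD_def qq_def F_def by simp
    also have "\<dots> \<le> - (a / 2 * \<tau>\<^sup>2) * DD - a * \<kappa>\<^sup>2 * F - c * b / 4 * qq
      - c * b / 4 * Q + c * b / 2 * ((norm p)\<^sup>2 - s)"
      using mult_right_mono[OF coefD, of DD] mult_right_mono[OF coefQ, of Q] nonneg(1,2)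
      unfolding mult_minus_left by linarith
    finally have up: "real k * (energy s (Suc k) - energy s k) \<le> \<dots>" .
    have eta: "(norm (b *\<^sub>R (x (Suc k) - p) + \<tau> *\<^sub>R (x (Suc k) - x k)))\<^sup>2 / 2 \<le> b\<^sup>2 * qq + \<tau>\<^sup>2 * DD"
    proof -
      define v w where "v = b *\<^sub>R (x (Suc k) - p)" and "w = \<tau> *\<^sub>R (x (Suc k) - x k)"
      have "0 \<le> (v - w) \<bullet> (v - w)"
        by simp
      then have "(norm (v + w))\<^sup>2 / 2 \<le> (norm v)\<^sup>2 + (norm w)\<^sup>2"
        unfolding power2_norm_eq_inner by (simp add: inner_simps inner_commute)
      then show ?thesis
        by (simp add: v_def w_def qq_def DD_def power_mult_distrib)
    qed
    have F': "(\<kappa> + 1) * (\<tau> + 1) * F \<le> \<kappa>\<^sup>2 * F"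
    proof (rule mult_right_mono)
      have "(\<kappa> + 1) * (\<tau> + 1) \<le> (\<kappa> + 1) * (\<kappa> - 1)"
        using K \<tau> by (intro mult_left_mono) auto
      then show "(\<kappa> + 1) * (\<tau> + 1) \<le> \<kappa>\<^sup>2"
        by (simp add: power2_eq_square algebra_simps)
    qed (use nonneg in simp)
    have Q': "c * (\<tau> + 1) / (2 * (\<kappa> + 1)) * Q \<le> c / 2 * Q"
      using c_pos \<tau> K nonneg by (intro mult_right_mono) (auto simp: field_simps)
    have "energy s (Suc k) = (norm (b *\<^sub>R (x (Suc k) - p) + \<tau> *\<^sub>R (x (Suc k) - x k)))\<^sup>2 / 2
      + a * b / 2 * qq + (\<kappa> + 1) * (\<tau> + 1) * F + c * (\<tau> + 1) / (2 * (\<kappa> + 1)) * Q"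
      unfolding energy_def by (simp add: \<kappa>_def \<tau>_def Q_def qq_def F_def algebra_simps)
    also have "\<dots> \<le> (b\<^sup>2 + a * b / 2) * qq + \<tau>\<^sup>2 * DD + \<kappa>\<^sup>2 * F + c / 2 * Q"
      using eta F' Q' unfolding distrib_right[of "b\<^sup>2"] by linarith
    finally have "\<delta> * energy s (Suc k) \<le> \<delta> * \<dots>"
      using delta_pos by simp
    also have "\<dots> = \<delta> * (b\<^sup>2 + a * b / 2) * qq + \<delta> * (\<tau>\<^sup>2 * DD) + \<delta> * (\<kappa>\<^sup>2 * F) + \<delta> * (c / 2) * Q"
      by (simp add: algebra_simps)
    also have "\<dots> \<le> c * b / 4 * qq + a / 2 * (\<tau>\<^sup>2 * DD) + a * (\<kappa>\<^sup>2 * F) + c * b / 4 * Q"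
    proof (intro add_mono mult_right_mono)
      have pos: "0 < b\<^sup>2 + a * b / 2"
        using ab by (intro add_pos_pos) auto
      have "\<delta> \<le> c * b / (4 * (b\<^sup>2 + a * b / 2))"
        by (simp add: \<delta>_def)
      also have "\<dots> = (c * b / 4) / (b\<^sup>2 + a * b / 2)"
        by simp
      finally show "\<delta> * (b\<^sup>2 + a * b / 2) \<le> c * b / 4"
        using pos by (simp only: pos_le_divide_eq)
      have \<delta>: "\<delta> \<le> a / 2"
        unfolding \<delta>_def by (rule min.cobounded1)
      then show "\<delta> \<le> a / 2" "\<delta> \<le> a"
        using ab by auto
      have "\<delta> * (c / 2) \<le> b / 2 * (c / 2)"
        using \<delta> ab c_pos by (intro mult_right_mono) auto
      then show "\<delta> * (c / 2) \<le> c * b / 4"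
        by (simp add: algebra_simps)
    qed (use nonneg in auto)
    finally show ?case
      using up by (simp add: algebra_simps)
  qed
qed

text \<open>Subtracting the equilibrium value of the recursion removes its constant term.\<close>

lemma energy_eventually_le:
  assumes "\<forall>\<^sub>F k in sequentially. s \<le> (norm (x k))\<^sup>2" and "\<epsilon> > 0"
  shows "\<forall>\<^sub>F k in sequentially. energy s k \<le> c * b / 2 * ((norm p)\<^sup>2 - s) / \<delta> + \<epsilon>"
proof -
  define E where "E = c * b / 2 * ((norm p)\<^sup>2 - s) / \<delta>"
  have "\<forall>\<^sub>F k in sequentially. real k * ((energy s (Suc k) - E) - (energy s k - E))
      \<le> - \<delta> * (energy s (Suc k) - E)"
    using energy_decay[OF assms(1)]
  proof eventually_elim
    case (elim k)
    moreover have "\<delta> * E = c * b / 2 * ((norm p)\<^sup>2 - s)"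
      using delta_pos by (simp add: E_def)
    ultimately show ?case
      by (simp add: algebra_simps)
  qed
  from logarithmic_decay_eventually_le[OF delta_pos assms(2) this] show ?thesis
    by eventually_elim (simp add: E_def)
qed

lemma values_tendsto: "(\<lambda>k. f (x k)) \<longlonglongrightarrow> f p"
proof -
  define C where "C = c * b / 2 * ((norm p)\<^sup>2 - 0) / \<delta> + 1"
  have large: "\<forall>\<^sub>F k in sequentially. max 1 \<alpha> \<le> real k"
    using filterlim_real_sequentially unfolding filterlim_at_top by blast
  have "\<forall>\<^sub>F k in sequentially. energy 0 k \<le> C"
    unfolding C_def by (rule energy_eventually_le) auto
  with large have upper: "\<forall>\<^sub>F k in sequentially. f (x k) \<le> f p + C * inverse (real k)"
  proof eventually_elim
    case (elim k)
    have "0 \<le> (norm (b *\<^sub>R (x k - p) + (real k - \<alpha>) *\<^sub>R (x k - x (k - 1))))\<^sup>2 / 2"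
      "0 \<le> a * b / 2 * (norm (x k - p))\<^sup>2"
      "0 \<le> c * (real k + 1 - \<alpha>) / (2 * real k) * ((norm (x k))\<^sup>2 - 0)"
      using a_pos b_gt c_pos elim(1) by auto
    then have "real k * (real k + 1 - \<alpha>) * (f (x k) - f p) \<le> C"
      using elim(2) unfolding energy_def by linarith
    moreover have "real k * 1 * (f (x k) - f p) \<le> real k * (real k + 1 - \<alpha>) * (f (x k) - f p)"
      using elim(1) minimiser by (intro mult_right_mono mult_left_mono) auto
    ultimately show ?case
      using elim(1) by (simp add: field_simps)
  qed
  have "(\<lambda>k. f p + C * inverse (real k)) \<longlonglongrightarrow> f p + C * 0"
    by (intro tendsto_intros lim_inverse_n)
  then show ?thesis
    using upper minimiser by (intro tendsto_sandwich[OF _ upper tendsto_const]) auto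
qed

lemma tendsto_outside_ball:
  assumes "\<forall>\<^sub>F k in sequentially. norm p \<le> norm (x k)"
  shows "x \<longlonglongrightarrow> p"
proof (rule tendstoI)
  fix e :: real
  assume "e > 0"
  have large: "\<forall>\<^sub>F k in sequentially. max 1 \<alpha> \<le> real k"
    using filterlim_real_sequentially unfolding filterlim_at_top by blast
  have out: "\<forall>\<^sub>F k in sequentially. (norm p)\<^sup>2 \<le> (norm (x k))\<^sup>2"
    using assms by eventually_elim (intro power_mono, auto)
  have "0 < a * b / 4 * e\<^sup>2"
    using a_pos b_gt \<open>e > 0\<close> by simp
  from energy_eventually_le[OF out this] out large show "\<forall>\<^sub>F k in sequentially. dist (x k) p < e"
  proof eventually_elim
    case (elim k)
    have "0 \<le> (norm (b *\<^sub>R (x k - p) + (real k - \<alpha>) *\<^sub>R (x k - x (k - 1))))\<^sup>2 / 2"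
      "0 \<le> real k * (real k + 1 - \<alpha>) * (f (x k) - f p)"
      "0 \<le> c * (real k + 1 - \<alpha>) / (2 * real k) * ((norm (x k))\<^sup>2 - (norm p)\<^sup>2)"
      using c_pos elim(2,3) minimiser by auto
    moreover have no_const: "c * b / 2 * ((norm p)\<^sup>2 - (norm p)\<^sup>2) / \<delta> = 0"
      by simp
    ultimately have "a * b / 2 * (norm (x k - p))\<^sup>2 \<le> a * b / 4 * e\<^sup>2"
      using elim(1) no_const unfolding energy_def by linarith
    also have "\<dots> < a * b / 2 * e\<^sup>2"
      using a_pos b_gt \<open>e > 0\<close> by simp
    finally have "(norm (x k - p))\<^sup>2 < e\<^sup>2"
      using a_pos b_gt by simp
    then show ?case
      using \<open>e > 0\<close> by (auto simp: dist_norm intro: power_less_imp_less_base)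
  qed
qed

end

section \<open>Convergence of the algorithm\<close>

theorem theorem13:
  fixes f :: "'a::{real_inner, complete_space} \<Rightarrow> real"
    and grad :: "'a \<Rightarrow> 'a"
    and c \<alpha> :: real
    and x y :: "nat \<Rightarrow> 'a"
    and xstar :: 'a
  assumes convex: "convex_on UNIV f"
    and gradient: "\<And>u. GDERIV f u :> grad u"
    and lipschitz: "\<And>S. bounded S \<Longrightarrow> \<exists>L. L-lipschitz_on S grad"
    and argmin_nonempty: "argmin_set f \<noteq> {}"
    and c_pos: "c > 0"
    and alpha_gt: "\<alpha> > 3"
    and y_def: "\<And>k. k \<ge> 1 \<Longrightarrow> y k = x k + (1 - \<alpha> / real k) *\<^sub>R (x k - x (k - 1))"
    and x_step: "\<And>k. k \<ge> 1 \<Longrightarrow> x (k + 1) = prox f (y k - (c / (real k)\<^sup>2) *\<^sub>R x k)"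
    and xstar_def: "xstar = arg_min_on norm (argmin_set f)"
  shows "liminf (\<lambda>k. ereal (norm (x k - xstar))) = 0
    \<and> ((\<forall>\<^sub>F k in sequentially. x k \<in> interior (ball 0 (norm xstar)))
         \<or> (\<forall>\<^sub>F k in sequentially. x k \<in> - ball 0 (norm xstar))
       \<longrightarrow> x \<longlonglongrightarrow> xstar)"
proof -
  have cont: "continuous_on UNIV f"
    using gradient unfolding gderiv_def
    by (intro continuous_at_imp_continuous_on ballI) (rule has_derivative_continuous)
  note min = arg_min_on_norm_argmin_set[OF convex cont argmin_nonempty xstar_def]
  interpret inertial_tikhonov_prox f c \<alpha> x xstar
  proof
    fix k u
    assume "k \<ge> (1::nat)"
    then show "f (x (Suc k)) + (x k + (1 - \<alpha> / real k) *\<^sub>R (x k - x (k - 1)) - (c / (real k)\<^sup>2) *\<^sub>R x k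
        - x (Suc k)) \<bullet> (u - x (Suc k)) \<le> f u"
      using prox_subgradient[OF convex cont min(1), of "y k - (c / (real k)\<^sup>2) *\<^sub>R x k" u]
        x_step[of k] y_def[of k] by simp
  qed (use c_pos alpha_gt min(1) in auto)
  have inside: "x \<longlonglongrightarrow> xstar" if "\<forall>\<^sub>F k in sequentially. x k \<in> interior (ball 0 (norm xstar))"
    using that by (intro minimising_sequence_in_ball_tendsto[OF convex min(2) values_tendsto])
      (auto elim: eventually_mono)
  have outside: "x \<longlonglongrightarrow> xstar" if "\<forall>\<^sub>F k in sequentially. x k \<in> - ball 0 (norm xstar)"
    using that by (intro tendsto_outside_ball) (auto elim: eventually_mono)
  have "liminf (\<lambda>k. ereal (norm (x k - xstar))) \<le> 0"
  proof (cases "\<exists>\<^sub>F k in sequentially. norm (x k) < norm xstar")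
    case True
    then have inf: "infinite {k. norm (x k) < norm xstar}"
      by (simp add: cofinite_eq_sequentially[symmetric] frequently_cofinite)
    obtain r :: "nat \<Rightarrow> nat" where r: "strict_mono r" and "\<forall>n. r n \<in> {k. norm (x k) < norm xstar}"
      using infinite_enumerate[OF inf] by blast
    then have r_in: "norm (x (r n)) \<le> norm xstar" for n
      by (simp add: less_imp_le)
    have "(\<lambda>n. f (x (r n))) \<longlonglongrightarrow> f xstar"
      using LIMSEQ_subseq_LIMSEQ[OF values_tendsto r] by (simp add: o_def)
    then have "(\<lambda>n. x (r n)) \<longlonglongrightarrow> xstar"
      using r_in by (intro minimising_sequence_in_ball_tendsto[OF convex min(2)]) auto
    then have "(\<lambda>n. norm (x (r n) - xstar)) \<longlonglongrightarrow> 0"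
      by (simp add: LIM_zero_iff tendsto_norm_zero)
    then have "(\<lambda>n. ereal (norm (x (r n) - xstar))) \<longlonglongrightarrow> 0"
      by (simp add: zero_ereal_def)
    then have "liminf ((\<lambda>k. ereal (norm (x k - xstar))) \<circ> r) = 0"
      by (intro lim_imp_Liminf) (auto simp: o_def)
    then show ?thesis
      using liminf_subseq_mono[OF r, of "\<lambda>k. ereal (norm (x k - xstar))"] by simp
  next
    case False
    then have "x \<longlonglongrightarrow> xstar"
      by (intro tendsto_outside_ball) (simp add: not_frequently not_less)
    then have "(\<lambda>k. norm (x k - xstar)) \<longlonglongrightarrow> 0"
      by (simp add: LIM_zero_iff tendsto_norm_zero)
    then have "(\<lambda>k. ereal (norm (x k - xstar))) \<longlonglongrightarrow> 0"
      by (simp add: zero_ereal_def)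
    then show ?thesis
      by (simp add: lim_imp_Liminf)
  qed
  moreover have "0 \<le> liminf (\<lambda>k. ereal (norm (x k - xstar)))"
    by (intro Liminf_bounded always_eventually) auto
  ultimately show ?thesis
    using inside outside by auto
qed

end
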